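(* Let $n\ge 1$ and $k$ be integers with $\lfloor n/2\rfloor \le k\le \lfloor (2n-2)/3\rfloor$. Then the cube polynomial of $\Phi^n_k$ is $$C(\Phi^n_k,x)=\sum_{j\ge 0}\binom{n-k-j-1}{2k-n+1}\binom{2k-n+1}{j}x^j.$$
   Context: A subword of a word is a block of consecutive letters. A binary word (over $\{0,1\}$) of length $n\ge 1$ is Padovan if it starts and ends with $0$, contains no subword $00$, and contains no subword $111$. For $n\ge1$ and $\lfloor n/2\rfloor\le k\le\lfloor(2n-2)/3\rfloor$, the weighted Padovan graph $\Phi^n_k$ is the simple graph whose vertices are all Padovan words of length $n$ with exactly $k$ letters $1$; two vertices are adjacent if one can be obtained from the other by replacing exactly one subword $01$ with $10$. The cube polynomial of a finite graph $G$ is $C(G,x)=\sum_{m\ge0}c_m(G)x^m$, where $c_m(G)$ is the number of induced subgraphs of $G$ isomorphic to the $m$-dimensional hypercube $Q_m$ (so $c_0(G)=|V(G)|$, $c_1(G)=|E(G)|$). Binomial coefficients $\binom{m}{r}$ are $0$ unless $0\le r\le m$. *)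

theory Defs
  imports
    "HOL-Library.Sublist"
    "HOL-Library.Groups_Big_Fun"
    "HOL-Computational_Algebra.Polynomial"
    "Graph_Theory.Graph_Theory"
begin

text \<open>
  Binary words are lists of Booleans, with False for the letter 0 and True for the letter 1.
  Subwords are contiguous: this is \<open>sublist\<close>, not \<open>subseq\<close>.
\<close>

definition padovan_word :: "bool list \<Rightarrow> bool" where
  "padovan_word w \<longleftrightarrow>
     w \<noteq> [] \<and> hd w = False \<and> last w = False \<and>
     \<not> sublist [False, False] w \<and> \<not> sublist [True, True, True] w"

definition padovan_words :: "nat \<Rightarrow> nat \<Rightarrow> bool list set" where
  "padovan_words n k = {w. padovan_word w \<and> length w = n \<and> count_list w True = k}"

definition swap_01_10 :: "bool list \<Rightarrow> bool list \<Rightarrow> bool" where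
  "swap_01_10 u v \<longleftrightarrow> (\<exists>p s. u = p @ [False, True] @ s \<and> v = p @ [True, False] @ s)"

text \<open>
  Simple graphs are represented as symmetric loop-free digraphs without parallel arcs
  (locale \<open>pair_graph\<close>), each edge being a pair of opposite arcs.
\<close>

definition padovan_graph :: "nat \<Rightarrow> nat \<Rightarrow> bool list pair_pre_digraph" where
  "padovan_graph n k =
     \<lparr> pverts = padovan_words n k,
       parcs = {(u, v). u \<in> padovan_words n k \<and> v \<in> padovan_words n k \<and>
                        (swap_01_10 u v \<or> swap_01_10 v u)} \<rparr>"

definition hypercube :: "nat \<Rightarrow> bool list pair_pre_digraph" where
  "hypercube m =
     \<lparr> pverts = {u. length u = m},
       parcs = {(u, v). length u = m \<and> length v = m \<and> card {i. i < m \<and> u ! i \<noteq> v ! i} = 1} \<rparr>"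

text \<open>
  Since \<open>induced_subgraph\<close> fixes the tail and head functions, an induced subgraph is
  determined by its vertex set and is counted exactly once.
\<close>

definition cube_count :: "nat \<Rightarrow> 'a pair_pre_digraph \<Rightarrow> nat" where
  "cube_count m G =
     card {H. induced_subgraph H (with_proj G) \<and> digraph_iso H (with_proj (hypercube m))}"

text \<open>
  \<open>Sum_any\<close> sums over a whole type and is meaningful when only finitely many terms are
  nonzero; for finite graphs this is the case by \<open>finite_cube_count\<close> below.
\<close>

definition cube_poly :: "'a pair_pre_digraph \<Rightarrow> int poly" where
  "cube_poly G = Sum_any (\<lambda>m. monom (int (cube_count m G)) m)"

definition binom :: "int \<Rightarrow> int \<Rightarrow> int" where
  "binom m r = (if 0 \<le> r \<and> r \<le> m then int (nat m choose nat r) else 0)"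


lemma finite_padovan_words: "finite (padovan_words n k)"
  by (rule finite_subset[OF _ finite_lists_length_eq[of "UNIV :: bool set" n]])
    (auto simp: padovan_words_def)

lemma swap_01_10_irrefl: "\<not> swap_01_10 u u"
  by (auto simp: swap_01_10_def)

lemma pair_graphI:
  assumes "finite (pverts G)" and "sym (parcs G)"
    and "\<And>u v. (u, v) \<in> parcs G \<Longrightarrow> u \<in> pverts G \<and> u \<noteq> v"
  shows "pair_graph G"
proof -
  have sub: "parcs G \<subseteq> pverts G \<times> pverts G"
    using assms(2,3) by (auto dest: symD)
  interpret pair_wf_digraph G
    by unfold_locales (use sub in auto)
  interpret pair_fin_digraph G
    by unfold_locales (use finite_subset[OF sub] assms(1) in auto)
  interpret pair_sym_digraph G
    by unfold_locales (use assms(2) in \<open>simp add: symmetric_def\<close>)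
  interpret pair_loopfree_digraph G
    by unfold_locales (use assms(3) in auto)
  show ?thesis ..
qed

lemma pair_graph_padovan_graph: "pair_graph (padovan_graph n k)"
  by (rule pair_graphI)
    (auto simp: padovan_graph_def finite_padovan_words swap_01_10_irrefl intro!: symI)

lemma pair_graph_hypercube: "pair_graph (hypercube m)"
proof (rule pair_graphI)
  show "finite (pverts (hypercube m))"
    using finite_lists_length_eq[of "UNIV :: bool set" m] by (simp add: hypercube_def)
  have "{i. i < m \<and> u ! i \<noteq> v ! i} = {i. i < m \<and> v ! i \<noteq> u ! i}" for u v :: "bool list"
    by auto
  then show "sym (parcs (hypercube m))"
    unfolding hypercube_def sym_def by (metis (no_types, lifting) case_prodD case_prodI
        mem_Collect_eq pair_pre_digraph.select_convs(2))
qed (auto simp: hypercube_def)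

lemma finite_cube_count:
  assumes "finite (pverts G)"
  shows "finite {m. cube_count m G \<noteq> 0}"
proof (rule finite_subset)
  show "{m. cube_count m G \<noteq> 0} \<subseteq> {..card (pverts G)}"
  proof (rule subsetI)
    fix m assume "m \<in> {m. cube_count m G \<noteq> 0}"
    then have "cube_count m G \<noteq> 0" by simp
    then obtain H where H: "induced_subgraph H (with_proj G)"
      and iso: "digraph_iso H (with_proj (hypercube m))"
      unfolding cube_count_def by (metis (mono_tags, lifting) Collect_empty_eq card.empty)
    from iso obtain f where f: "pre_digraph.digraph_isomorphism H f"
      and eq: "with_proj (hypercube m) = app_iso f H"
      by (auto simp: digraph_iso_def)
    have "2 ^ m = card {u :: bool list. length u = m}"
      using card_lists_length_eq[of "UNIV :: bool set" m] by simp
    also have "\<dots> = card (verts (app_iso f H))"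
      by (simp add: eq[symmetric] hypercube_def del: verts_app_iso)
    also have "\<dots> = card (verts H)"
      using f by (simp add: card_image pre_digraph.digraph_isomorphism_def)
    also have "\<dots> \<le> card (pverts G)"
      using H assms by (auto simp: induced_subgraph_def subgraph_def intro: card_mono)
    finally show "m \<in> {..card (pverts G)}"
      by (meson atMost_iff less_exp less_imp_le order_trans)
  qed
qed simp

lemma coeff_cube_poly:
  assumes "finite (pverts G)"
  shows "coeff (cube_poly G) m = int (cube_count m G)"
proof -
  have eq: "{i. monom (int (cube_count i G)) i \<noteq> 0} = {i. cube_count i G \<noteq> 0}"
    by auto
  show ?thesis
    using finite_cube_count[OF assms]
    by (auto simp: cube_poly_def Sum_any.expand_set eq coeff_sum)
qed

end

theory Submission
  imports Defs
begin

text \<open>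
  A Padovan word is \<open>0 1\<^sup>a 0 1\<^sup>b 0 \<dots> 0\<close> with all exponents in \<open>{1, 2}\<close>. Recording which exponents
  are 2 gives an arbitrary word of length \<open>t = n - k - 1\<close> with \<open>r = 2k - n + 1\<close> ones, and the exchange
  of 01 for 10 is the same operation on both sides. Replacing a word by its height function, the
  number of ones in each prefix, embeds the graph into an integer lattice in which adjacent points
  differ by 1 in exactly one coordinate. Opposite sides of a 4-cycle of such a lattice are parallel,
  so every hypercube is an axis-parallel unit box: a minimal point \<open>b\<close> with a set \<open>D\<close> of directions.
  For the height function \<open>b\<close> of a word \<open>u\<close>, the box consists of height functions exactly if \<open>u\<close>
  reads 01 at each position in \<open>D\<close>. Hence the number of \<open>m\<close>-cubes is the sum over \<open>u\<close> of the binomial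
  coefficients (number of occurrences of 01 in \<open>u\<close> over \<open>m\<close>), which satisfies a Pascal-type recursion.
\<close>

subsection \<open>Padovan words as sequences of runs\<close>

text \<open>The letters of \<open>u\<close> say which of the runs of ones have length two.\<close>

primrec encode :: "bool list \<Rightarrow> bool list" where
  "encode [] = [False]"
| "encode (b # u) = False # True # (if b then True # encode u else encode u)"

definition words :: "nat \<Rightarrow> nat \<Rightarrow> bool list set" where
  "words t r = {u. length u = t \<and> count_list u True = r}"

lemma hd_encode [simp]: "hd (encode u) = False" "encode u \<noteq> []" "[] \<noteq> encode u"
  by (cases u; simp)+

lemma encode_neq [simp]: "encode u \<noteq> True # v" "encode u \<noteq> False # False # v"
  "True # v \<noteq> encode u" "False # False # v \<noteq> encode u"
  by (cases u; auto)+

lemma encode_inject [simp]: "encode u = encode v \<longleftrightarrow> u = v"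
proof (induction u arbitrary: v)
  case Nil
  then show ?case by (cases v) auto
next
  case (Cons a u)
  then show ?case by (cases v) auto
qed

lemma length_encode: "length (encode u) = 2 * length u + count_list u True + 1"
  by (induction u) auto

lemma count_encode: "count_list (encode u) True = length u + count_list u True"
  by (induction u) auto

lemma padovan_word_Nil [simp]: "\<not> padovan_word []"
  by (simp add: padovan_word_def)

lemma padovan_word_True [simp]: "\<not> padovan_word (True # w)"
  by (simp add: padovan_word_def)

lemma padovan_word_singleton [simp]: "padovan_word [False]"
  by (simp add: padovan_word_def sublist_Cons_right)

text \<open>The equations strip the first run of ones and keep the zero after it as the new first
  letter, so a word can be analysed run by run.\<close>

lemma padovan_word_simps [simp]:
  "\<not> padovan_word (False # False # w)"
  "\<not> padovan_word [False, True]"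
  "\<not> padovan_word [False, True, True]"
  "\<not> padovan_word (False # True # True # True # w)"
  "padovan_word (False # True # False # w) = padovan_word (False # w)"
  "padovan_word (False # True # True # False # w) = padovan_word (False # w)"
  by (auto simp: padovan_word_def sublist_Cons_right)

lemma padovan_word_encode: "padovan_word (encode u)"
proof (induction u)
  case (Cons b u)
  obtain w where "encode u = False # w"
    by (metis hd_encode list.collapse)
  with Cons show ?case by auto
qed simp

text \<open>Unless the word ends with its leading 0, one or two ones must follow before the next 0.
  That 0 closes the first run and at the same time opens the remaining word
  \<open>False # v\<close>.\<close>

lemma padovan_word_cases:
  assumes "padovan_word w"
  shows "w = [False] \<or> (\<exists>v. padovan_word (False # v) \<and>
    (w = False # True # False # v \<or> w = False # True # True # False # v))"
proof -
  obtain x where x: "w = False # x"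
    using assms by (cases w; cases "hd w") auto
  show ?thesis
  proof (cases x)
    case (Cons b y)
    with x assms have b: "b" by (cases b) auto
    with x Cons assms obtain c z where y: "y = c # z" by (cases y) auto
    show ?thesis
    proof (cases c)
      case True
      with x Cons b y assms obtain d s where z: "z = d # s" by (cases z) auto
      with x Cons b y True assms show ?thesis by (cases d) auto
    qed (use x Cons b y assms in auto)
  qed (use x in auto)
qed

lemma padovan_word_imp_encode: "padovan_word w \<Longrightarrow> w \<in> range encode"
proof (induction w rule: length_induct)
  case (1 w)
  have IH: "v \<in> range encode" if "length v < length w" "padovan_word v" for v
    using 1 that by blast
  consider "w = [False]" | v where "w = False # True # False # v" "padovan_word (False # v)"
    | v where "w = False # True # True # False # v" "padovan_word (False # v)"
    using \<open>padovan_word w\<close> by (auto dest: padovan_word_cases)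
  then show ?case
  proof cases
    case 1
    then show ?thesis by (metis encode.simps(1) rangeI)
  next
    case 2
    with IH[of "False # v"] obtain u where "False # v = encode u" by auto
    with 2 have "w = encode (False # u)" by simp
    then show ?thesis by blast
  next
    case 3
    with IH[of "False # v"] obtain u where "False # v = encode u" by auto
    with 3 have "w = encode (True # u)" by simp
    then show ?thesis by blast
  qed
qed

text \<open>If \<open>u\<close> has length \<open>t\<close> and \<open>r\<close> ones, its encoding
  has length \<open>2 * t + r + 1\<close> and \<open>t + r\<close> ones. Solving for
  \<open>t\<close> and \<open>r\<close> gives the two parameters; the assumptions make both
  subtractions exact.\<close>

lemma padovan_words_eq:
  assumes "k < n" "n \<le> 2 * k + 1"
  shows "padovan_words n k = encode ` words (n - k - 1) (2 * k + 1 - n)"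
proof -
  have len: "length (encode u) = n \<and> count_list (encode u) True = k \<longleftrightarrow>
      u \<in> words (n - k - 1) (2 * k + 1 - n)" for u
    using assms by (auto simp: length_encode count_encode words_def)
  show ?thesis
  proof (intro set_eqI iffI)
    fix w assume w: "w \<in> padovan_words n k"
    then obtain u where "w = encode u"
      using padovan_word_imp_encode unfolding padovan_words_def by blast
    with w len[of u] show "w \<in> encode ` words (n - k - 1) (2 * k + 1 - n)"
      by (simp add: padovan_words_def)
  next
    fix w assume "w \<in> encode ` words (n - k - 1) (2 * k + 1 - n)"
    then obtain u where "w = encode u" "u \<in> words (n - k - 1) (2 * k + 1 - n)" by blast
    with len[of u] show "w \<in> padovan_words n k"
      by (simp add: padovan_words_def padovan_word_encode)
  qed
qed

section \<open>The exchange of 01 for 10 on encoded words\<close>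

lemma swap_Nil [simp]: "\<not> swap_01_10 [] v" "\<not> swap_01_10 u []"
  by (auto simp: swap_01_10_def)

text \<open>The disjuncts correspond to a nonempty and an empty prefix \<open>p\<close>. As a simp
  rule this replaces the choice of \<open>p\<close> and \<open>s\<close> by recursion over both
  words.\<close>

lemma swap_Cons [simp]:
  "swap_01_10 (a # u) (b # v) \<longleftrightarrow>
     a = b \<and> swap_01_10 u v \<or> \<not> a \<and> b \<and> (\<exists>s. u = True # s \<and> v = False # s)"
    (is "?L \<longleftrightarrow> ?R")
proof
  assume ?L
  then obtain p s where p: "a # u = p @ [False, True] @ s" "b # v = p @ [True, False] @ s"
    unfolding swap_01_10_def by blast
  then show ?R by (cases p) (auto simp: swap_01_10_def)
next
  assume ?R
  then show ?L
  proof (elim disjE conjE exE)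
    fix s assume "\<not> a" "b" "u = True # s" "v = False # s"
    then show ?L unfolding swap_01_10_def by (intro exI[of _ "[]"] exI[of _ s]) simp
  next
    assume "a = b" "swap_01_10 u v"
    then obtain p s where "u = p @ [False, True] @ s" "v = p @ [True, False] @ s"
      unfolding swap_01_10_def by blast
    with \<open>a = b\<close> show ?L
      unfolding swap_01_10_def by (intro exI[of _ "a # p"] exI[of _ s]) simp
  qed
qed

text \<open>An exchange moves a zero one place to the right, so the run before it gains a one and
  the run after it loses one. As runs have length 1 or 2, lengths 1, 2 become 2, 1, which is 01 to
  10 in the unencoded word.\<close>

lemma swap_encode:
  "length u = length v \<Longrightarrow> swap_01_10 (encode u) (encode v) \<longleftrightarrow> swap_01_10 u v"
proof (induction u v rule: list_induct2)
  case (Cons a u b v)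
  \<comment> \<open>Here the first run would have to shrink. In \<open>**\<close> it grows, so the
    zero ending it moves and the second run must shrink from two to one.\<close>
  have *: "\<not> swap_01_10 (True # x) (encode y)" for x y
    by (cases y) auto
  have **: "swap_01_10 (encode u) (True # encode v) \<longleftrightarrow> (\<exists>s. u = True # s \<and> v = False # s)"
    by (cases u; cases v; auto)
  show ?case
    using Cons.IH * ** by (cases a; cases b; simp)
qed simp

subsection \<open>Height functions\<close>

text \<open>Total on \<open>nat\<close>, hence constant past the end of the word; integer values
  make heights points of a lattice in which differences may be negative.\<close>

primrec ones :: "bool list \<Rightarrow> nat \<Rightarrow> int" where
  "ones [] i = 0"
| "ones (b # u) i = (case i of 0 \<Rightarrow> 0 | Suc j \<Rightarrow> of_bool b + ones u j)"

lemma ones_0 [simp]: "ones u 0 = 0"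
  by (cases u) auto

lemma ones_ge: "length u \<le> i \<Longrightarrow> ones u i = int (count_list u True)"
  by (induction u arbitrary: i) (auto split: nat.split)

lemma ones_Suc: "ones u (Suc i) = ones u i + of_bool (i < length u \<and> u ! i)"
  by (induction u arbitrary: i) (auto split: nat.split)

lemma ones_surj:
  assumes "f 0 = 0" "\<And>i. f (Suc i) - f i \<in> {0, 1}" "\<And>i. t \<le> i \<Longrightarrow> f i = f t"
  shows "\<exists>u. length u = t \<and> ones u = f"
  using assms
proof (induction t arbitrary: f)
  case 0
  from 0(1) 0(3) have "f i = 0" for i by (metis le0)
  then show ?case by (intro exI[of _ "[]"]) (simp add: fun_eq_iff)
next
  case (Suc t)
  \<comment> \<open>The heights of the tail: the first letter, whose value is \<open>f 1\<close>, is
    dropped and its contribution subtracted.\<close>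
  define g where "g i = f (Suc i) - f 1" for i
  have "\<exists>u. length u = t \<and> ones u = g"
  proof (rule Suc.IH)
    show "g i = g t" if "t \<le> i" for i
      using Suc.prems(3)[of "Suc i"] that by (simp add: g_def)
  qed (use Suc.prems(2) in \<open>auto simp: g_def\<close>)
  then obtain u where u: "length u = t" "ones u = g" by blast
  have "f 1 \<in> {0, 1}" using Suc.prems(1) Suc.prems(2)[of 0] by simp
  then have "ones ((f 1 = 1) # u) = f"
    using Suc.prems(1) u by (auto simp: fun_eq_iff g_def split: nat.split)
  with u show ?case by (intro exI[of _ "(f 1 = 1) # u"]) simp
qed

text \<open>Height functions are the lattice paths from 0 to \<open>r\<close> with increments 0 or
  1. This description no longer mentions words, so membership of a lattice point can be tested
  coordinate by coordinate.\<close>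

lemma ones_words:
  "ones ` words t r =
     {f. f 0 = 0 \<and> (\<forall>i. f (Suc i) - f i \<in> {0, 1}) \<and> (\<forall>i\<ge>t. f i = int r)}" (is "_ = ?P")
proof
  show "ones ` words t r \<subseteq> ?P"
    by (auto simp: words_def ones_ge ones_Suc)
  show "?P \<subseteq> ones ` words t r"
  proof
    fix f assume f: "f \<in> ?P"
    with ones_surj[of f t] obtain u where u: "length u = t" "ones u = f" by auto
    then have "int (count_list u True) = int r"
      using f ones_ge[of u t] by auto
    with u show "f \<in> ones ` words t r" by (auto simp: words_def)
  qed
qed

lemma ones_inject: "length u = length v \<Longrightarrow> ones u = ones v \<longleftrightarrow> u = v"
proof (induction u v rule: list_induct2)
  case (Cons a u b v)
  have "a = b \<and> ones u = ones v" if eq: "ones (a # u) = ones (b # v)"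
  proof -
    have "of_bool a + ones u i = (of_bool b :: int) + ones v i" for i
      using fun_cong[OF eq, of "Suc i"] by simp
    from this[of 0] this show ?thesis by (auto simp: fun_eq_iff)
  qed
  with Cons.IH show ?case by (auto simp del: ones.simps)
qed simp

section \<open>Exchanges as unit steps of the height function\<close>

definition unit_step :: "('i \<Rightarrow> int) \<Rightarrow> ('i \<Rightarrow> int) \<Rightarrow> bool" where
  "unit_step p q \<longleftrightarrow> (\<exists>c. q = p(c := p c + 1))"

text \<open>Exchanging letters \<open>i\<close> and \<open>i + 1\<close> changes only the prefix of
  length \<open>i + 1\<close>, which gains a one; all other prefixes keep their number of
  ones.\<close>

lemma swap_iff_unit_step:
  "length u = length v \<Longrightarrow> swap_01_10 u v \<longleftrightarrow> unit_step (ones u) (ones v)"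
proof (induction u v rule: list_induct2)
  case Nil
  then show ?case by (auto simp: unit_step_def fun_eq_iff)
next
  case (Cons a u b v)
  show ?case
  proof
    assume "swap_01_10 (a # u) (b # v)"
    then consider "a = b" "unit_step (ones u) (ones v)"
      | s where "\<not> a" "b" "u = True # s" "v = False # s"
      using Cons.IH by auto
    then show "unit_step (ones (a # u)) (ones (b # v))"
    proof cases
      case 1
      then obtain c where "ones v = (ones u)(c := ones u c + 1)" by (auto simp: unit_step_def)
      with 1 show ?thesis
        unfolding unit_step_def
        by (intro exI[of _ "Suc c"]) (auto simp: fun_eq_iff split: nat.split)
    next
      case 2
      then show ?thesis
        unfolding unit_step_def
        by (intro exI[of _ 1]) (auto simp: fun_eq_iff split: nat.split)
    qed
  next
    assume "unit_step (ones (a # u)) (ones (b # v))"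
    then obtain c where c: "ones (b # v) i = ((ones (a # u))(c := ones (a # u) c + 1)) i" for i
      unfolding unit_step_def by metis
    have c0: "c \<noteq> 0" using c[of 0] by (cases c) auto
    have step: "of_bool b + ones v i = of_bool a + ones u i + of_bool (Suc i = c)" for i
      using c[of "Suc i"] by auto
    show "swap_01_10 (a # u) (b # v)"
    \<comment> \<open>If the height at 1 changes, the first letters differ. Otherwise they agree,
      and the tails differ by a unit step at \<open>c - 1\<close>.\<close>
    proof (cases "c = 1")
      case True
      then have ab: "\<not> a" "b" using step[of 0] by (auto simp: of_bool_def split: if_splits)
      \<comment> \<open>From coordinate 2 on the full heights agree, so the tail \<open>v\<close>
        must make up for the gained first letter. This forces the second letters to be 1 in
        \<open>u # ...\<close> order before and 0 after the exchange.\<close>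
      have ov: "ones v i = ones u i - 1" if "i > 0" for i
        using step[of i] ab True that by simp
      obtain x s where u: "u = x # s"
        using Cons.hyps ov[of 1] by (cases u) auto
      then obtain y s' where v: "v = y # s'"
        using Cons.hyps by (cases v) auto
      have *: "of_bool y + ones s' i = (of_bool x :: int) + ones s i - 1" for i
        using ov[of "Suc i"] u v by simp
      from *[of 0] have xy: "x" "\<not> y" by (auto simp: of_bool_def split: if_splits)
      with * have "ones s' = ones s" by auto
      then have "s' = s" using Cons.hyps u v ones_inject by auto
      with u v xy ab show ?thesis by simp
    next
      case False
      then have ab: "a = b" using step[of 0] c0 by (auto simp: of_bool_def split: if_splits)
      have "ones v = (ones u)(c - 1 := ones u (c - 1) + 1)"
        using step ab c0 by (auto simp: fun_eq_iff)
      then have "unit_step (ones u) (ones v)" unfolding unit_step_def by blast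
      then show ?thesis using Cons.IH ab by simp
    qed
  qed
qed

subsection \<open>Induced hypercubes\<close>

lemma induced_subgraph_iff_induce:
  assumes "wf_digraph G"
  shows "induced_subgraph H G \<longleftrightarrow> (\<exists>X \<subseteq> verts G. H = G \<restriction> X)"
proof
  assume "induced_subgraph H G"
  then show "\<exists>X \<subseteq> verts G. H = G \<restriction> X"
    by (intro exI[of _ "verts H"])
      (auto simp: induced_subgraph_def subgraph_def compatible_def induce_subgraph_def)
next
  assume "\<exists>X \<subseteq> verts G. H = G \<restriction> X"
  with assms show "induced_subgraph H G"
    by (auto simp: induced_subgraph_def subgraph_def compatible_def induce_subgraph_def
        wf_digraph_def)
qed

text \<open>An arc is the pair of its end points, so the arc map of an isomorphism is determined by
  its vertex map. What remains is a bijection of vertices that preserves and reflects arcs.\<close>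

lemma digraph_iso_induce_iff:
  assumes K: "parcs K \<subseteq> pverts K \<times> pverts K"
  shows "digraph_iso (with_proj G \<restriction> X) (with_proj K) \<longleftrightarrow>
    (\<exists>h. bij_betw h X (pverts K) \<and>
         (\<forall>u\<in>X. \<forall>v\<in>X. (u, v) \<in> parcs G \<longleftrightarrow> (h u, h v) \<in> parcs K))" (is "?L \<longleftrightarrow> ?R")
proof
  assume ?L
  then obtain f where f: "pre_digraph.digraph_isomorphism (with_proj G \<restriction> X) f"
    and eq: "with_proj K = app_iso f (with_proj G \<restriction> X)"
    by (auto simp: digraph_iso_def)
  define h where "h = iso_verts f"
  have V: "pverts K = h ` X"
    using arg_cong[OF eq, of verts] by (simp add: h_def)
  have A: "parcs K = iso_arcs f ` {e \<in> parcs G. fst e \<in> X \<and> snd e \<in> X}"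
    using arg_cong[OF eq, of arcs] by simp
  \<comment> \<open>The target has the projections as tail and head, which pins down the image of
    every arc.\<close>
  have tl: "iso_tail f = fst" and hd: "iso_head f = snd"
    using arg_cong[OF eq, of tail] arg_cong[OF eq, of head] by simp_all
  have inj: "inj_on h X"
    using f by (simp add: pre_digraph.digraph_isomorphism_def h_def)
  have arc: "iso_arcs f (u, v) = (h u, h v)" if "(u, v) \<in> parcs G" "u \<in> X" "v \<in> X" for u v
    using f that
    by (auto simp: pre_digraph.digraph_isomorphism_def h_def tl hd induce_subgraph_def
        prod_eq_iff)
  have "(u, v) \<in> parcs G \<longleftrightarrow> (h u, h v) \<in> parcs K" if uv: "u \<in> X" "v \<in> X" for u v
  proof
    assume "(u, v) \<in> parcs G"
    with uv arc[of u v] show "(h u, h v) \<in> parcs K"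
      unfolding A by (metis (mono_tags, lifting) fst_conv image_eqI mem_Collect_eq snd_conv)
  next
    assume "(h u, h v) \<in> parcs K"
    then obtain u' v' where *: "(u', v') \<in> parcs G" "u' \<in> X" "v' \<in> X"
      "(h u, h v) = iso_arcs f (u', v')"
      unfolding A by auto
    with arc have "h u = h u'" "h v = h v'" by auto
    with inj uv * have "u = u'" "v = v'" by (auto dest: inj_onD)
    with * show "(u, v) \<in> parcs G" by simp
  qed
  with V inj show ?R by (intro exI[of _ h]) (auto simp: bij_betw_def)
next
  assume ?R
  then obtain h where h: "inj_on h X" "h ` X = pverts K"
    and arc: "\<And>u v. u \<in> X \<Longrightarrow> v \<in> X \<Longrightarrow> (u, v) \<in> parcs G \<longleftrightarrow> (h u, h v) \<in> parcs K"
    by (auto simp: bij_betw_def)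
  define f where
    "f = \<lparr>iso_verts = h, iso_arcs = map_prod h h, iso_head = snd, iso_tail = fst\<rparr>"
  have "pre_digraph.digraph_isomorphism (with_proj G \<restriction> X) f"
    using h by (auto simp: pre_digraph.digraph_isomorphism_def f_def wf_digraph_def
        induce_subgraph_def inj_on_def)
  moreover have "parcs K = map_prod h h ` {e \<in> parcs G. fst e \<in> X \<and> snd e \<in> X}"
  proof (intro set_eqI iffI)
    fix e assume e: "e \<in> parcs K"
    with K obtain x y where "e = (x, y)" "x \<in> h ` X" "y \<in> h ` X"
      unfolding h(2) by blast
    then obtain u v where "e = (h u, h v)" "u \<in> X" "v \<in> X" by blast
    with e arc show "e \<in> map_prod h h ` {e \<in> parcs G. fst e \<in> X \<and> snd e \<in> X}"
      by (auto intro!: image_eqI[of _ _ "(u, v)"])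
  qed (use arc in auto)
  then have "with_proj K = app_iso f (with_proj G \<restriction> X)"
    using h by (simp add: app_iso_def f_def with_proj_def induce_subgraph_def)
  ultimately show ?L unfolding digraph_iso_def by blast
qed

section \<open>Hypercubes as the subsets of a finite set\<close>

definition cube_adj :: "'a set \<Rightarrow> 'a set \<Rightarrow> bool" where
  "cube_adj S T \<longleftrightarrow> (\<exists>i. i \<notin> S \<and> T = insert i S \<or> i \<notin> T \<and> S = insert i T)"

lemma cube_adj_iff_sym_diff: "cube_adj S T \<longleftrightarrow> (\<exists>i. (S - T) \<union> (T - S) = {i})"
proof
  assume "\<exists>i. (S - T) \<union> (T - S) = {i}"
  then obtain i where "(S - T) \<union> (T - S) = {i}" ..
  then have "\<And>j. (j \<in> S \<longleftrightarrow> j \<in> T) \<longleftrightarrow> j \<noteq> i" by blast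
  then have "i \<notin> S \<and> T = insert i S \<or> i \<notin> T \<and> S = insert i T" by blast
  then show "cube_adj S T" unfolding cube_adj_def ..
qed (auto simp: cube_adj_def)

text \<open>Adjacency says that the symmetric difference is a singleton, and an injective image
  commutes with symmetric difference and preserves cardinality.\<close>

lemma cube_adj_image:
  assumes "inj_on f A" "S \<subseteq> A" "T \<subseteq> A"
  shows "cube_adj (f ` S) (f ` T) \<longleftrightarrow> cube_adj S T"
proof -
  have "(f ` S - f ` T) \<union> (f ` T - f ` S) = f ` ((S - T) \<union> (T - S))"
    using assms by (auto dest: inj_onD)
  moreover have "(\<exists>i. f ` B = {i}) \<longleftrightarrow> (\<exists>i. B = {i})" if "B \<subseteq> A" for B
  proof -
    have "inj_on f B" using assms(1) that by (rule inj_on_subset)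
    then have "card (f ` B) = card B" by (rule card_image)
    then show ?thesis by (metis card_1_singleton_iff One_nat_def)
  qed
  moreover have "(S - T) \<union> (T - S) \<subseteq> A" using assms by blast
  ultimately show ?thesis
    unfolding cube_adj_iff_sym_diff by metis
qed

lemma bij_betw_support:
  "bij_betw (\<lambda>u. {i. i < m \<and> u ! i}) {u :: bool list. length u = m} (Pow {..<m})"
proof (rule bij_betwI[where g = "\<lambda>S. map (\<lambda>i. i \<in> S) [0..<m]"])
  show "map (\<lambda>i. i \<in> {i. i < m \<and> u ! i}) [0..<m] = u" if "u \<in> {u. length u = m}" for u
    using that by (auto intro!: nth_equalityI)
qed auto

lemma hypercube_arc_iff:
  assumes "length u = m" "length v = m"
  shows "(u, v) \<in> parcs (hypercube m) \<longleftrightarrow>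
    cube_adj {i. i < m \<and> u ! i} {i. i < m \<and> v ! i}"
proof -
  have "({i. i < m \<and> u ! i} - {i. i < m \<and> v ! i}) \<union> ({i. i < m \<and> v ! i} - {i. i < m \<and> u ! i})
      = {i. i < m \<and> u ! i \<noteq> v ! i}"
    by auto
  with assms show ?thesis
    by (simp add: hypercube_def cube_adj_iff_sym_diff card_1_singleton_iff)
qed

text \<open>An isomorphism from the cube onto the subgraph induced on \<open>X\<close>. It points
  from the cube to the graph so that positions of vertices become functions of the subset
  \<open>S\<close>.\<close>

definition cube_param :: "'a pair_pre_digraph \<Rightarrow> nat \<Rightarrow> 'a set \<Rightarrow> (nat set \<Rightarrow> 'a) \<Rightarrow> bool" where
  "cube_param G m X g \<longleftrightarrow> bij_betw g (Pow {..<m}) X \<and>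
     (\<forall>S \<subseteq> {..<m}. \<forall>T \<subseteq> {..<m}. (g S, g T) \<in> parcs G \<longleftrightarrow> cube_adj S T)"

lemma digraph_iso_hypercube_iff:
  "digraph_iso (with_proj G \<restriction> X) (with_proj (hypercube m)) \<longleftrightarrow> (\<exists>g. cube_param G m X g)"
proof -
  define s :: "bool list \<Rightarrow> nat set" where "s u = {i. i < m \<and> u ! i}" for u
  let ?Q = "{u :: bool list. length u = m}"
  have s: "bij_betw s ?Q (Pow {..<m})"
    using bij_betw_support[of m] by (simp add: s_def[abs_def])
  have arc: "(u, v) \<in> parcs (hypercube m) \<longleftrightarrow> cube_adj (s u) (s v)" if "u \<in> ?Q" "v \<in> ?Q" for u v
    using hypercube_arc_iff that by (simp add: s_def)
  have V: "pverts (hypercube m) = ?Q" by (simp add: hypercube_def)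
  have "(\<exists>h. bij_betw h X ?Q \<and>
         (\<forall>u\<in>X. \<forall>v\<in>X. (u, v) \<in> parcs G \<longleftrightarrow> (h u, h v) \<in> parcs (hypercube m))) \<longleftrightarrow>
       (\<exists>g. cube_param G m X g)" (is "(\<exists>h. ?P h) \<longleftrightarrow> _")
  proof
    assume "\<exists>h. ?P h"
    then obtain h where h: "bij_betw h X ?Q"
      and ha: "\<And>u v. u \<in> X \<Longrightarrow> v \<in> X \<Longrightarrow> (u, v) \<in> parcs G \<longleftrightarrow> (h u, h v) \<in> parcs (hypercube m)"
      by blast
    have k: "bij_betw (s \<circ> h) X (Pow {..<m})" using h s by (rule bij_betw_trans)
    define g where "g = inv_into X (s \<circ> h)"
    have g: "bij_betw g (Pow {..<m}) X" unfolding g_def using k by (rule bij_betw_inv_into)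
    have sg: "s (h (g S)) = S" "g S \<in> X" if "S \<subseteq> {..<m}" for S
      using bij_betw_inv_into_right[OF k, of S] bij_betwE[OF g] that by (auto simp: g_def)
    have "h u \<in> ?Q" if "u \<in> X" for u using h that by (rule bij_betw_apply)
    then have "(g S, g T) \<in> parcs G \<longleftrightarrow> cube_adj S T" if "S \<subseteq> {..<m}" "T \<subseteq> {..<m}" for S T
      using sg[OF that(1)] sg[OF that(2)] ha arc by simp
    with g have "cube_param G m X g" by (simp add: cube_param_def)
    then show "\<exists>g. cube_param G m X g" by (rule exI[where x = g])
  next
    assume "\<exists>g. cube_param G m X g"
    then obtain g where "cube_param G m X g" by (rule exE)
    then have g: "bij_betw g (Pow {..<m}) X"
      and ga: "\<And>S T. S \<subseteq> {..<m} \<Longrightarrow> T \<subseteq> {..<m} \<Longrightarrow> (g S, g T) \<in> parcs G \<longleftrightarrow> cube_adj S T"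
      by (simp_all add: cube_param_def)
    have k: "bij_betw (g \<circ> s) ?Q X" using s g by (rule bij_betw_trans)
    define h where "h = inv_into ?Q (g \<circ> s)"
    have h: "bij_betw h X ?Q" unfolding h_def using k by (rule bij_betw_inv_into)
    have gh: "g (s (h u)) = u" "h u \<in> ?Q" "s (h u) \<subseteq> {..<m}" if "u \<in> X" for u
      using bij_betw_inv_into_right[OF k that] bij_betw_apply[OF h that]
      by (auto simp: h_def s_def)
    have "(u, v) \<in> parcs G \<longleftrightarrow> (h u, h v) \<in> parcs (hypercube m)" if "u \<in> X" "v \<in> X" for u v
      using gh[OF that(1)] gh[OF that(2)] ga[of "s (h u)" "s (h v)"] arc by simp
    with h have "?P h" by simp
    then show "\<exists>h. ?P h" by (rule exI[where x = h])
  qed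
  moreover have "parcs (hypercube m) \<subseteq> pverts (hypercube m) \<times> pverts (hypercube m)"
    by (auto simp: hypercube_def)
  ultimately show ?thesis by (simp add: digraph_iso_induce_iff V)
qed

text \<open>An induced subgraph is determined by its vertex set, so counting subgraphs amounts to
  counting the sets \<open>X\<close>.\<close>

lemma cube_count_eq_card_cube_param:
  assumes "parcs G \<subseteq> pverts G \<times> pverts G"
  shows "cube_count m G = card {X. X \<subseteq> pverts G \<and> (\<exists>g. cube_param G m X g)}"
proof -
  have "wf_digraph (with_proj G)"
    using assms by (auto simp: wf_digraph_def)
  then have "{H. induced_subgraph H (with_proj G) \<and> digraph_iso H (with_proj (hypercube m))} =
      induce_subgraph (with_proj G) ` {X. X \<subseteq> pverts G \<and> (\<exists>g. cube_param G m X g)}"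
    by (auto simp: induced_subgraph_iff_induce digraph_iso_hypercube_iff[symmetric])
  moreover have "inj (induce_subgraph (with_proj G))"
    by (metis injI induce_subgraph_verts)
  ultimately show ?thesis
    unfolding cube_count_def by (simp add: card_image inj_on_subset)
qed

subsection \<open>Hypercubes in an integer lattice\<close>

abbreviation lattice_adj :: "('i \<Rightarrow> int) \<Rightarrow> ('i \<Rightarrow> int) \<Rightarrow> bool" where
  "lattice_adj p q \<equiv> unit_step p q \<or> unit_step q p"

lemma lattice_adj_iff:
  "lattice_adj p q \<longleftrightarrow> (\<exists>c e. (e = 1 \<or> e = - 1) \<and> q = p(c := p c + e))"
proof
  assume "lattice_adj p q"
  then show "\<exists>c e. (e = 1 \<or> e = - 1) \<and> q = p(c := p c + e)"
  proof
    assume "unit_step q p"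
    then obtain c where "p = q(c := q c + 1)" unfolding unit_step_def ..
    then have "q = p(c := p c + (-1))" by simp
    then show ?thesis by blast
  qed (auto simp: unit_step_def)
next
  assume "\<exists>c e. (e = 1 \<or> e = - 1) \<and> q = p(c := p c + e)"
  then obtain c e where e: "e = 1 \<or> e = - 1" and q: "q = p(c := p c + e)" by blast
  from e show "lattice_adj p q"
  proof
    assume "e = - 1"
    with q have "p = q(c := q c + 1)" by simp
    then show ?thesis unfolding unit_step_def by blast
  qed (use q in \<open>auto simp: unit_step_def\<close>)
qed

text \<open>Both routes from \<open>p\<close> to \<open>r\<close> have the same total displacement,
  and neither returns to \<open>p\<close>. Hence the first steps use different coordinates, and the
  second step of one route repeats the first step of the other.\<close>

lemma lattice_parallelogram:
  assumes "lattice_adj p q" "lattice_adj p q'" "lattice_adj q r" "lattice_adj q' r"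
    and "p \<noteq> r" "q \<noteq> q'"
  shows "r c - q' c = q c - p c" and "q c = p c \<or> q' c = p c"
proof -
  obtain i e where e: "e = 1 \<or> e = - 1" and q: "q = p(i := p i + e)"
    using assms(1) unfolding lattice_adj_iff by blast
  obtain i' e' where e': "e' = 1 \<or> e' = - 1" and q': "q' = p(i' := p i' + e')"
    using assms(2) unfolding lattice_adj_iff by blast
  obtain j f where f: "f = 1 \<or> f = - 1" and r: "r = q(j := q j + f)"
    using assms(3) unfolding lattice_adj_iff by blast
  obtain j' f' where f': "f' = 1 \<or> f' = - 1" and r': "r = q'(j' := q' j' + f')"
    using assms(4) unfolding lattice_adj_iff by blast
  have pt: "p x + (if x = i then e else 0) + (if x = j then f else 0) =
      p x + (if x = i' then e' else 0) + (if x = j' then f' else 0)" for x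
    using fun_cong[OF trans[OF r[symmetric] r'], of x] q q' by (auto split: if_splits)
  have no_return: "\<not> (j = i \<and> f = - e)" "\<not> (j' = i' \<and> f' = - e')"
    using \<open>p \<noteq> r\<close> r r' q q' by auto
  \<comment> \<open>In a common coordinate the first steps would have opposite signs; as neither
    route may undo its first step, the totals there would differ.\<close>
  have ii': "i \<noteq> i'"
  proof
    assume "i = i'"
    with \<open>q \<noteq> q'\<close> q q' have "e \<noteq> e'" by auto
    with pt[of i] pt[of j] \<open>i = i'\<close> no_return e e' f f' show False by (auto split: if_splits)
  qed
  with pt[of i] no_return e f f' have "j' = i \<and> f' = e" by (auto split: if_splits)
  with q q' r' ii' show "r c - q' c = q c - p c" and "q c = p c \<or> q' c = p c" by auto
qed

section \<open>Axis-parallel unit boxes\<close>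

definition shift :: "('i \<Rightarrow> int) \<Rightarrow> 'i set \<Rightarrow> 'i \<Rightarrow> int" where
  "shift b S = (\<lambda>c. b c + of_bool (c \<in> S))"

definition box :: "('i \<Rightarrow> int) \<Rightarrow> 'i set \<Rightarrow> ('i \<Rightarrow> int) set" where
  "box b D = shift b ` Pow D"

lemma shift_inject [simp]: "shift b S = shift b T \<longleftrightarrow> S = T"
  by (auto simp: shift_def fun_eq_iff of_bool_def split: if_splits)

lemma unit_step_shift: "unit_step (shift b S) (shift b T) \<longleftrightarrow> (\<exists>i. i \<notin> S \<and> T = insert i S)"
proof
  assume "unit_step (shift b S) (shift b T)"
  then obtain c where "shift b T = (shift b S)(c := shift b S c + 1)"
    unfolding unit_step_def ..
  then have *: "of_bool (x \<in> T) = (of_bool (x \<in> S) + of_bool (x = c) :: int)" for x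
    by (auto simp: shift_def fun_eq_iff of_bool_def split: if_splits)
  have "x \<in> T \<longleftrightarrow> x \<in> insert c S" for x using *[of x] by (auto simp: of_bool_def split: if_splits)
  moreover have "c \<notin> S" using *[of c] by (auto simp: of_bool_def split: if_splits)
  ultimately show "\<exists>i. i \<notin> S \<and> T = insert i S" by blast
next
  assume "\<exists>i. i \<notin> S \<and> T = insert i S"
  then obtain i where "i \<notin> S" "T = insert i S" by blast
  then have "shift b T = (shift b S)(i := shift b S i + 1)"
    by (auto simp: shift_def)
  then show "unit_step (shift b S) (shift b T)" unfolding unit_step_def by blast
qed

lemma lattice_adj_shift: "lattice_adj (shift b S) (shift b T) \<longleftrightarrow> cube_adj S T"
  unfolding unit_step_shift cube_adj_def by blast

text \<open>The point \<open>b\<close> is the pointwise least element of its box, hence determined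
  by it; the greatest corner \<open>shift b D\<close> then determines \<open>D\<close>.\<close>

lemma box_inject:
  assumes eq: "box b D = box b' D'"
  shows "b = b' \<and> D = D'"
proof -
  have mem: "shift b S \<in> box b D" if "S \<subseteq> D" for b :: "'a \<Rightarrow> int" and D S
    using that by (auto simp: box_def)
  have ge: "b c \<le> p c" if "p \<in> box b D" for b :: "'a \<Rightarrow> int" and D p c
    using that by (auto simp: box_def shift_def)
  have shift_empty: "shift b {} = b" for b :: "'a \<Rightarrow> int" by (simp add: shift_def)
  have "b \<in> box b' D'" "b' \<in> box b D"
    using mem[of "{}" D b] mem[of "{}" D' b'] eq shift_empty by auto
  then have b: "b = b'" by (intro ext antisym ge)
  have "shift b D \<in> box b' D'" "shift b' D' \<in> box b D" using mem eq by auto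
  with b show ?thesis by (auto simp: box_def)
qed

text \<open>Opposite edges of a square have equal displacement, so each cube direction
  \<open>i\<close> has one displacement throughout: a sign \<open>e i\<close> in a coordinate
  \<open>d i\<close>. Distinct directions use distinct coordinates.\<close>

lemma lattice_cube_is_box:
  fixes g :: "nat set \<Rightarrow> 'i \<Rightarrow> int"
  assumes inj: "inj_on g (Pow {..<m})"
    and adj: "\<And>S i. S \<subseteq> {..<m} \<Longrightarrow> i < m \<Longrightarrow> i \<notin> S \<Longrightarrow> lattice_adj (g S) (g (insert i S))"
  shows "\<exists>b D. finite D \<and> card D = m \<and> g ` Pow {..<m} = box b D"
proof -
  have neq: "g S \<noteq> g T" if "S \<subseteq> {..<m}" "T \<subseteq> {..<m}" "S \<noteq> T" for S T
    using inj that by (auto dest: inj_onD)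
  have par: "g (insert i (insert j S)) c - g (insert j S) c = g (insert i S) c - g S c"
      "g (insert i S) c = g S c \<or> g (insert j S) c = g S c"
    if "S \<subseteq> {..<m}" "i < m" "j < m" "i \<notin> S" "j \<notin> S" "i \<noteq> j" for S i j c
  proof -
    have adj1: "lattice_adj (g S) (g (insert i S))" "lattice_adj (g S) (g (insert j S))"
      "lattice_adj (g (insert j S)) (g (insert i (insert j S)))"
      using adj that by auto
    have adj2: "lattice_adj (g (insert i S)) (g (insert i (insert j S)))"
      using adj[of "insert i S" j] that by (simp add: insert_commute)
    have distinct: "g S \<noteq> g (insert i (insert j S))" "g (insert i S) \<noteq> g (insert j S)"
      by (rule neq; use that in blast)+
    show "g (insert i (insert j S)) c - g (insert j S) c = g (insert i S) c - g S c"
      "g (insert i S) c = g S c \<or> g (insert j S) c = g S c"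
      using lattice_parallelogram[OF adj1(1,2) adj2 adj1(3) distinct] by blast+
  qed
  \<comment> \<open>The edge is transported to the empty set across one square for each element of
    \<open>S\<close>.\<close>
  have step: "g (insert i S) c - g S c = g {i} c - g {} c"
    if "finite S" "S \<subseteq> {..<m}" "i < m" "i \<notin> S" for S i c
    using that
  proof (induction S rule: finite_induct)
    case (insert j S)
    then show ?case using par(1)[of S i j c] by auto
  qed simp
  have "\<forall>i<m. \<exists>d e. (e = 1 \<or> e = - 1) \<and> g {i} = (g {})(d := g {} d + e)"
    using adj[of "{}"] unfolding lattice_adj_iff by simp
  then obtain d e where e: "\<And>i. i < m \<Longrightarrow> e i = 1 \<or> e i = - 1"
    and d: "\<And>i. i < m \<Longrightarrow> g {i} = (g {})(d i := g {} (d i) + e i)"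
    by metis
  \<comment> \<open>At the vertex \<open>g {}\<close>, two edges in the same coordinate would
    contradict \<open>par(2)\<close>.\<close>
  have inj_d: "inj_on d {..<m}"
  proof (rule inj_onI, rule ccontr)
    fix i j assume "i \<in> {..<m}" "j \<in> {..<m}" "d i = d j" "i \<noteq> j"
    with par(2)[of "{}" i j "d i"] d e show False by fastforce
  qed
  have g_eq: "(\<forall>i<m. g S (d i) = g {} (d i) + (if i \<in> S then e i else 0)) \<and>
      (\<forall>c. c \<notin> d ` {..<m} \<longrightarrow> g S c = g {} c)" if "finite S" "S \<subseteq> {..<m}" for S
    using that
  proof (induction S rule: finite_induct)
    case (insert j S)
    then have "g (insert j S) c = g S c + (if c = d j then e j else 0)" for c
      using step[of S j c] d[of j] by auto
    moreover have "d i = d j \<longleftrightarrow> i = j" if "i < m" for i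
      using inj_d insert.prems that by (auto dest: inj_onD)
    ultimately show ?case using insert by auto
  qed simp
  define N where "N = {i \<in> {..<m}. e i = - 1}"
  define D where "D = d ` {..<m}"
  have N: "N \<subseteq> {..<m}" by (auto simp: N_def)
  \<comment> \<open>Flipping the negative directions moves the base point to the minimum of the cube.\<close>
  have g_shift: "g S = shift (g N) (d ` ((S - N) \<union> (N - S)))" if S: "S \<subseteq> {..<m}" for S
  proof
    fix c
    have fin: "finite S" "finite N" using S N finite_subset by blast+
    show "g S c = shift (g N) (d ` ((S - N) \<union> (N - S))) c"
    proof (cases "c \<in> d ` {..<m}")
      case True
      then obtain i where i: "i < m" "c = d i" by auto
      have "d i \<in> d ` ((S - N) \<union> (N - S)) \<longleftrightarrow> i \<in> (S - N) \<union> (N - S)"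
        using inj_d i S N by (intro inj_on_image_mem_iff[of d "{..<m}"]) auto
      with i g_eq[OF fin(1) S] g_eq[OF fin(2) N] e[OF i(1)] show ?thesis
        by (auto simp: shift_def N_def)
    next
      case False
      then have "c \<notin> d ` ((S - N) \<union> (N - S))" using S N by blast
      with False g_eq[OF fin(1) S] g_eq[OF fin(2) N] show ?thesis by (simp add: shift_def)
    qed
  qed
  have "g ` Pow {..<m} = box (g N) D"
  proof (intro set_eqI iffI)
    fix p assume "p \<in> g ` Pow {..<m}"
    then obtain S where S: "S \<subseteq> {..<m}" "p = g S" by auto
    then have "d ` ((S - N) \<union> (N - S)) \<subseteq> D" using N by (auto simp: D_def)
    with g_shift[OF S(1)] S(2) show "p \<in> box (g N) D" by (auto simp: box_def)
  next
    fix p assume "p \<in> box (g N) D"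
    then obtain T where T: "T \<subseteq> D" "p = shift (g N) T" by (auto simp: box_def)
    then obtain U where U: "U \<subseteq> {..<m}" "T = d ` U" by (auto simp: D_def subset_image_iff)
    \<comment> \<open>Symmetric difference with \<open>N\<close> is an involution, so this recovers
      the subset from its flipped form \<open>U\<close>.\<close>
    define S where "S = (U - N) \<union> (N - U)"
    have "S \<subseteq> {..<m}" "(S - N) \<union> (N - S) = U" using U N by (auto simp: S_def)
    then have "p = g S" "S \<in> Pow {..<m}" using g_shift[of S] T(2) U(2) by simp_all
    then show "p \<in> g ` Pow {..<m}" by (rule image_eqI)
  qed
  moreover have "finite D" "card D = m" using inj_d by (auto simp: D_def card_image)
  ultimately show ?thesis by blast
qed

text \<open>Under \<open>h\<close> a cube becomes a box inside the image, and every such box comes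
  from an induced cube because lattice adjacency within a box is cube adjacency. A box determines
  \<open>b\<close> and \<open>D\<close>, so pairs may be counted instead.\<close>

lemma cube_count_lattice_embedded:
  assumes wf: "parcs G \<subseteq> pverts G \<times> pverts G"
    and inj: "inj_on h (pverts G)"
    and arc: "\<And>u v. u \<in> pverts G \<Longrightarrow> v \<in> pverts G \<Longrightarrow>
                (u, v) \<in> parcs G \<longleftrightarrow> lattice_adj (h u) (h v)"
  shows "cube_count m G =
    card {(b, D). finite D \<and> card D = m \<and> box b D \<subseteq> h ` pverts G}"
proof -
  let ?X = "{X. X \<subseteq> pverts G \<and> (\<exists>g. cube_param G m X g)}"
  let ?B = "{(b, D). finite D \<and> card D = m \<and> box b D \<subseteq> h ` pverts G}"
  have "image h ` ?X = (\<lambda>(b, D). box b D) ` ?B"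
  proof (intro set_eqI iffI)
    fix Y assume "Y \<in> image h ` ?X"
    then obtain X g where X: "X \<subseteq> pverts G" "Y = h ` X" and g: "cube_param G m X g" by auto
    have gX: "inj_on g (Pow {..<m})" "g ` Pow {..<m} = X"
      and ga: "\<And>S T. S \<subseteq> {..<m} \<Longrightarrow> T \<subseteq> {..<m} \<Longrightarrow> (g S, g T) \<in> parcs G \<longleftrightarrow> cube_adj S T"
      using g unfolding cube_param_def bij_betw_def by auto
    have "\<exists>b D. finite D \<and> card D = m \<and> (h \<circ> g) ` Pow {..<m} = box b D"
    proof (rule lattice_cube_is_box)
      show "inj_on (h \<circ> g) (Pow {..<m})"
        using gX X inj by (auto intro!: comp_inj_on intro: inj_on_subset)
      fix S i assume S: "S \<subseteq> {..<m}" "i < m" "i \<notin> S"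
      then have "(g S, g (insert i S)) \<in> parcs G"
        using ga[of S "insert i S"] by (auto simp: cube_adj_def)
      with wf arc[of "g S" "g (insert i S)"]
      show "lattice_adj ((h \<circ> g) S) ((h \<circ> g) (insert i S))" by auto
    qed
    moreover have "(h \<circ> g) ` Pow {..<m} = Y" using gX(2) X(2) by (metis image_comp)
    ultimately obtain b D where "finite D" "card D = m" "Y = box b D" by auto
    with X show "Y \<in> (\<lambda>(b, D). box b D) ` ?B"
      by (intro image_eqI[where x = "(b, D)"]) auto
  next
    fix Y assume "Y \<in> (\<lambda>(b, D). box b D) ` ?B"
    then obtain b D where D: "finite D" "card D = m" "Y = box b D" "Y \<subseteq> h ` pverts G" by auto
    define X where "X = {v \<in> pverts G. h v \<in> Y}"
    have hX: "bij_betw h X Y"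
      using D(4) inj by (auto simp: bij_betw_def X_def inj_on_def)
    \<comment> \<open>Numbering the directions lets subsets of \<open>{..<m}\<close> label the
      corners of the box.\<close>
    obtain e where e: "bij_betw e {..<m} D"
      using D ex_bij_betw_nat_finite[of D] by (auto simp: atLeast0LessThan)
    define s where "s S = shift b (e ` S)" for S
    have s: "bij_betw s (Pow {..<m}) Y"
    proof -
      have "bij_betw (image e) (Pow {..<m}) (Pow D)" using e by (rule bij_betw_Pow)
      moreover have "bij_betw (shift b) (Pow D) Y"
        using D(3) by (auto simp: bij_betw_def box_def inj_on_def)
      ultimately show ?thesis
        using bij_betw_trans[of "image e" _ _ "shift b"] by (simp add: s_def[abs_def] comp_def)
    qed
    define g where "g S = inv_into X h (s S)" for S
    have g: "bij_betw g (Pow {..<m}) X"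
      using bij_betw_trans[OF s bij_betw_inv_into[OF hX]] by (simp add: g_def[abs_def] comp_def)
    have hg: "h (g S) = s S" "g S \<in> X" if "S \<subseteq> {..<m}" for S
      using bij_betw_inv_into_right[OF hX, of "s S"] bij_betwE[OF s] bij_betwE[OF g] that
      by (auto simp: g_def)
    have "(g S, g T) \<in> parcs G \<longleftrightarrow> cube_adj S T" if "S \<subseteq> {..<m}" "T \<subseteq> {..<m}" for S T
    proof -
      have "(g S, g T) \<in> parcs G \<longleftrightarrow> lattice_adj (s S) (s T)"
        using arc[of "g S" "g T"] hg[OF that(1)] hg[OF that(2)] by (simp add: X_def)
      also have "\<dots> \<longleftrightarrow> cube_adj S T"
        unfolding s_def lattice_adj_shift
        by (rule cube_adj_image[OF bij_betw_imp_inj_on[OF e] that])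
      finally show ?thesis .
    qed
    with g have "cube_param G m X g" by (simp add: cube_param_def)
    moreover have "X \<subseteq> pverts G" "Y = h ` X" using hX by (auto simp: X_def bij_betw_def)
    ultimately show "Y \<in> image h ` ?X" by blast
  qed
  moreover have "card (image h ` ?X) = card ?X"
  proof (intro card_image inj_onI)
    fix X X' assume "X \<in> ?X" "X' \<in> ?X" "h ` X = h ` X'"
    then show "X = X'" using inj_on_image_eq_iff[OF inj] by auto
  qed
  moreover have "card ((\<lambda>(b, D). box b D) ` ?B) = card ?B"
    by (intro card_image inj_onI) (auto dest: box_inject)
  ultimately show ?thesis using cube_count_eq_card_cube_param[OF wf] by simp
qed

subsection \<open>Counting\<close>

lemma finite_words [simp]: "finite (words t r)"
  by (rule finite_subset[OF _ finite_lists_length_eq[of "UNIV :: bool set" t]])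
    (auto simp: words_def)

text \<open>An occurrence of 01 is recorded by the index of its 1. This is also the length of the
  prefix ending in its 0, the one height that the exchange raises.\<close>

definition ascents :: "bool list \<Rightarrow> nat set" where
  "ascents u = {Suc i | i. Suc i < length u \<and> \<not> u ! i \<and> u ! Suc i}"

lemma finite_ascents [simp]: "finite (ascents u)"
  by (rule finite_subset[of _ "{..length u}"]) (auto simp: ascents_def)

lemma ascents_simps: "0 \<notin> ascents u"
  "Suc i \<in> ascents u \<longleftrightarrow> Suc i < length u \<and> \<not> u ! i \<and> u ! Suc i"
  by (auto simp: ascents_def)

text \<open>Raising the height at \<open>c\<close> alone is possible only if the increment into
  \<open>c\<close> is 0 and the one out of \<open>c\<close> is 1. Conversely, two ascents are never
  neighbours, so several of them can be raised independently.\<close>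

lemma box_subset_ones_words:
  assumes u: "u \<in> words t r"
  shows "box (ones u) D \<subseteq> ones ` words t r \<longleftrightarrow> D \<subseteq> ascents u"
proof
  assume sub: "box (ones u) D \<subseteq> ones ` words t r"
  show "D \<subseteq> ascents u"
  proof
    fix c assume "c \<in> D"
    define f where "f = shift (ones u) {c}"
    have "f \<in> box (ones u) D" using \<open>c \<in> D\<close> by (auto simp: f_def box_def)
    then have "f \<in> ones ` words t r" using sub by blast
    then have f: "f 0 = 0" "\<And>i. f (Suc i) - f i \<in> {0, 1}" by (auto simp: ones_words)
    from f(1) obtain i where c: "c = Suc i"
      by (cases c) (auto simp: f_def shift_def)
    have "\<not> (i < length u \<and> u ! i)"
      using f(2)[of i] by (auto simp: f_def shift_def c ones_Suc)
    moreover have "Suc i < length u \<and> u ! Suc i"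
      using f(2)[of "Suc i"]
      by (simp add: f_def shift_def c ones_Suc[of u "Suc i"] of_bool_def split: if_splits)
    ultimately show "c \<in> ascents u" by (simp add: c ascents_simps)
  qed
next
  assume sub: "D \<subseteq> ascents u"
  show "box (ones u) D \<subseteq> ones ` words t r"
  proof
    fix f assume "f \<in> box (ones u) D"
    then obtain S where S: "S \<subseteq> ascents u" and f: "f = shift (ones u) S"
      using sub by (auto simp: box_def)
    have "f 0 = 0" using S ascents_simps(1) by (auto simp: f shift_def)
    moreover have "f (Suc i) - f i \<in> {0, 1}" for i
    proof -
      have "\<not> (i < length u \<and> u ! i) \<and> i \<notin> S" if "Suc i \<in> S"
      proof -
        from that S have "\<not> u ! i" by (auto simp: ascents_simps)
        moreover have "i \<notin> S" using S \<open>\<not> u ! i\<close> by (cases i) (auto simp: ascents_simps)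
        ultimately show ?thesis by simp
      qed
      moreover have "i < length u \<and> u ! i" if "i \<in> S"
        using S that by (cases i) (auto simp: ascents_simps)
      ultimately show ?thesis by (auto simp: f shift_def ones_Suc)
    qed
    \<comment> \<open>All ascents lie below the length \<open>t\<close>, so the final height is
      untouched.\<close>
    moreover have "f i = int r" if "t \<le> i" for i
    proof -
      have "i \<notin> S" using S u that by (cases i) (auto simp: ascents_simps words_def)
      then show ?thesis using u that by (simp add: f shift_def words_def ones_ge)
    qed
    ultimately show "f \<in> ones ` words t r" by (simp add: ones_words)
  qed
qed

lemma ascents_Cons:
  "ascents (b # u) = Suc ` ascents u \<union> (if \<not> b \<and> u \<noteq> [] \<and> hd u then {1} else {})"
proof (rule set_eqI)
  fix c
  show "c \<in> ascents (b # u) \<longleftrightarrow>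
      c \<in> Suc ` ascents u \<union> (if \<not> b \<and> u \<noteq> [] \<and> hd u then {1} else {})"
  proof (cases c)
    case 0
    then show ?thesis by (auto simp: ascents_simps)
  next
    case (Suc i)
    then show ?thesis
      by (cases i; cases u) (auto simp: ascents_simps inj_image_mem_iff)
  qed
qed

lemma card_ascents_Cons:
  "card (ascents (b # u)) = card (ascents u) + of_bool (\<not> b \<and> u \<noteq> [] \<and> hd u)"
proof -
  have "1 \<notin> Suc ` ascents u" using ascents_simps(1) by auto
  then show ?thesis by (simp add: ascents_Cons card_image)
qed

section \<open>Evaluation of the sum over words\<close>

lemma words_0: "words 0 r = (if r = 0 then {[]} else {})"
  by (auto simp: words_def)

lemma words_Suc_0: "words (Suc t) 0 = Cons False ` words t 0"
  by (auto simp: words_def length_Suc_conv split: if_splits)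

lemma words_Suc_Suc:
  "words (Suc t) (Suc r) = Cons False ` words t (Suc r) \<union> Cons True ` words t r"
  by (auto simp: words_def length_Suc_conv split: if_splits)

lemma sum_words_Suc_Suc:
  "(\<Sum>u\<in>words (Suc t) (Suc r). f u) =
     (\<Sum>u\<in>words t (Suc r). f (False # u)) + (\<Sum>u\<in>words t r. f (True # u))"
  unfolding words_Suc_Suc by (subst sum.union_disjoint) (auto simp: sum.reindex)

definition ascent_sum :: "nat \<Rightarrow> nat \<Rightarrow> nat \<Rightarrow> nat" where
  "ascent_sum t r m = (\<Sum>u\<in>words t r. card (ascents u) choose m)"

text \<open>The terms arise by deleting a leading 0 that is not part of a chosen ascent, a leading
  1, or a leading 01 whose ascent is chosen. Pascal's rule separates the first from the
  third.\<close>

lemma ascent_sum_rec: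
  "ascent_sum (Suc (Suc t)) (Suc r) (Suc m) =
     ascent_sum (Suc t) (Suc r) (Suc m) + ascent_sum (Suc t) r (Suc m) + ascent_sum t r m"
  by (simp add: ascent_sum_def sum_words_Suc_Suc[of _ "Suc t"] sum_words_Suc_Suc[of _ t]
      card_ascents_Cons sum.distrib)

lemma ascents_words_0: "u \<in> words t 0 \<Longrightarrow> ascents u = {}"
  by (auto simp: words_def ascents_def count_list_0_iff in_set_conv_nth)

lemma card_words: "card (words t r) = t choose r"
proof (induction t arbitrary: r)
  case 0
  then show ?case by (simp add: words_0)
next
  case (Suc t)
  show ?case
  proof (cases r)
    case 0
    with Suc show ?thesis by (simp add: words_Suc_0 card_image)
  next
    case (Suc r')
    with Suc.IH show ?thesis
      using sum_words_Suc_Suc[of "\<lambda>_. 1 :: nat" t r'] by simp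
  qed
qed

text \<open>Contracting each chosen 01 to a marked 1 explains the product: a word of length
  \<open>t - m\<close> with \<open>r\<close> ones, \<open>m\<close> of them marked. The proof checks
  that the product satisfies the recursion.\<close>

lemma ascent_sum_eq: "ascent_sum t r m = (t - m choose r) * (r choose m)"
proof (induction t arbitrary: r m rule: less_induct)
  case (less t)
  consider "m = 0" | "r = 0" | "t = 0" "r > 0"
    | r' m' where "t = 1" "r = Suc r'" "m = Suc m'"
    | t' r' m' where "t = Suc (Suc t')" "r = Suc r'" "m = Suc m'"
    by (metis One_nat_def gr0_conv_Suc neq0_conv)
  then show ?case
  proof cases
    case 1
    then show ?thesis by (simp add: ascent_sum_def card_words)
  next
    case 2
    have "ascent_sum t 0 m = card (words t 0) * (0 choose m)"
      by (simp add: ascent_sum_def ascents_words_0)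
    with 2 show ?thesis by (simp add: card_words)
  next
    case 3
    then show ?thesis by (simp add: ascent_sum_def words_0)
  next
    case 4
    then show ?thesis
      by (simp add: ascent_sum_def sum_words_Suc_Suc words_0 card_ascents_Cons ascents_def)
  next
    case 5
    have "ascent_sum t r m = (t' - m' choose Suc r') * (Suc r' choose Suc m') +
        (t' - m' choose r') * (r' choose Suc m') + (t' - m' choose r') * (r' choose m')"
      using 5 less.IH by (simp add: ascent_sum_rec)
    \<comment> \<open>Pascal's rule is used twice: on the lower factors of the last two terms, then
      on the factors in \<open>t' - m'\<close>.\<close>
    also have "\<dots> = (Suc t' - m' choose Suc r') * (Suc r' choose Suc m')"
    proof (cases "m' \<le> t'")
      case True
      then show ?thesis by (simp add: Suc_diff_le algebra_simps)
    next
      \<comment> \<open>Both truncated differences are 0 here; for \<open>r' = 0\<close> the term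
        \<open>0 choose m'\<close> vanishes because \<open>m' > 0\<close>.\<close>
      case False
      then show ?thesis by (cases r') auto
    qed
    finally show ?thesis using 5 by simp
  qed
qed

lemma cube_count_padovan_graph:
  assumes "k < n" "n \<le> 2 * k + 1"
  shows "cube_count m (padovan_graph n k) =
    (n - k - 1 - m choose (2 * k + 1 - n)) * (2 * k + 1 - n choose m)"
proof -
  define t where "t = n - k - 1"
  define r where "r = 2 * k + 1 - n"
  \<comment> \<open>Heights are taken of the unencoded word, whose letters are unrestricted.\<close>
  define h where "h = ones \<circ> inv encode"
  let ?G = "padovan_graph n k"
  have V: "pverts ?G = encode ` words t r"
    using padovan_words_eq[OF assms] by (simp add: padovan_graph_def t_def r_def)
  have h: "h (encode u) = ones u" for u
    by (simp add: h_def inj_def)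
  have len: "length u = t" if "u \<in> words t r" for u using that by (simp add: words_def)
  have inj_ones: "inj_on ones (words t r)"
    using len ones_inject by (auto simp: inj_on_def)
  have "cube_count m ?G = card {(b, D). finite D \<and> card D = m \<and> box b D \<subseteq> h ` pverts ?G}"
  proof (rule cube_count_lattice_embedded)
    show "parcs ?G \<subseteq> pverts ?G \<times> pverts ?G" by (auto simp: padovan_graph_def)
    show "inj_on h (pverts ?G)"
      using inj_ones by (auto simp: V h inj_on_def)
    fix x y assume xy: "x \<in> pverts ?G" "y \<in> pverts ?G"
    then obtain u v where u: "u \<in> words t r" "x = encode u" and v: "v \<in> words t r" "y = encode v"
      by (auto simp: V)
    have "(x, y) \<in> parcs ?G \<longleftrightarrow> swap_01_10 x y \<or> swap_01_10 y x"
      using xy by (simp add: padovan_graph_def)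
    then show "(x, y) \<in> parcs ?G \<longleftrightarrow> lattice_adj (h x) (h y)"
      using u v len by (simp add: h swap_encode swap_iff_unit_step)
  qed
  also have "h ` pverts ?G = ones ` words t r"
    by (simp add: V image_image h)
  also have "{(b, D). finite D \<and> card D = m \<and> box b D \<subseteq> ones ` words t r} =
      map_prod ones id ` (SIGMA u:words t r. {D. D \<subseteq> ascents u \<and> card D = m})"
  proof (intro set_eqI iffI)
    fix p :: "(nat \<Rightarrow> int) \<times> nat set"
    assume "p \<in> {(b, D). finite D \<and> card D = m \<and> box b D \<subseteq> ones ` words t r}"
    then obtain b D where p: "p = (b, D)" "card D = m" "box b D \<subseteq> ones ` words t r" by auto
    \<comment> \<open>The minimal corner belongs to its box, so it is itself the height function of
      some word \<open>u\<close>.\<close>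
    have "b = shift b {}" by (simp add: shift_def)
    then have "b \<in> box b D" unfolding box_def by blast
    with p obtain u where u: "u \<in> words t r" "b = ones u" by blast
    with p box_subset_ones_words have "D \<subseteq> ascents u" by simp
    with p u show "p \<in> map_prod ones id ` (SIGMA u:words t r. {D. D \<subseteq> ascents u \<and> card D = m})"
      by (auto intro!: image_eqI[of _ _ "(u, D)"])
  next
    fix p assume "p \<in> map_prod ones id ` (SIGMA u:words t r. {D. D \<subseteq> ascents u \<and> card D = m})"
    then obtain u D where "p = (ones u, D)" "u \<in> words t r" "D \<subseteq> ascents u" "card D = m" by auto
    then show "p \<in> {(b, D). finite D \<and> card D = m \<and> box b D \<subseteq> ones ` words t r}"
      using box_subset_ones_words finite_subset[OF _ finite_ascents] by auto
  qed
  also have "card \<dots> = card (SIGMA u:words t r. {D. D \<subseteq> ascents u \<and> card D = m})"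
    using inj_ones by (intro card_image) (auto simp: inj_on_def)
  also have "\<dots> = ascent_sum t r m"
    by (simp add: ascent_sum_def n_subsets card_SigmaI)
  finally show ?thesis by (simp add: ascent_sum_eq t_def r_def)
qed

lemma binom_int [simp]: "binom (int a) (int b) = int (a choose b)"
  by (simp add: binom_def binomial_eq_0)

theorem theorem5p2:
  fixes n k :: nat
  assumes "n \<ge> 1"
    and "n div 2 \<le> k"
    and "k \<le> (2 * n - 2) div 3"
  shows "cube_poly (padovan_graph n k) =
    Sum_any (\<lambda>j::nat. monom
      (binom (int n - int k - int j - 1) (2 * int k - int n + 1) *
       binom (2 * int k - int n + 1) (int j)) j)"
proof -
  \<comment> \<open>The upper bound on \<open>k\<close> gives the first inequality, the lower bound
    the second.\<close>
  have nk: "k < n" "n \<le> 2 * k + 1" using assms by auto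
  define t where "t = n - k - 1"
  define r where "r = 2 * k + 1 - n"
  have r: "2 * int k - int n + 1 = int r" using nk by (simp add: r_def of_nat_diff)
  have "int (cube_count j (padovan_graph n k)) =
      binom (int n - int k - int j - 1) (2 * int k - int n + 1) *
      binom (2 * int k - int n + 1) (int j)" for j
  proof (cases "j \<le> t")
    case True
    then have t: "int n - int k - int j - 1 = int (t - j)"
      using nk by (simp add: t_def of_nat_diff)
    show ?thesis
      unfolding cube_count_padovan_graph[OF nk] r t by (simp add: t_def r_def)
  next
    \<comment> \<open>Here \<open>t - j\<close> truncates to 0 while the integer upper index is
      negative. Both sides vanish: for \<open>r > 0\<close> by \<open>0 choose r\<close>, for
      \<open>r = 0\<close> by \<open>0 choose j\<close> with \<open>j > 0\<close>.\<close>
    case False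
    then have "int n - int k - int j - 1 < 0" using nk by (simp add: t_def)
    then have "binom (int n - int k - int j - 1) (int r) = 0" by (simp add: binom_def)
    moreover have "(t - j choose r) * (r choose j) = 0" using False by (cases r) auto
    ultimately show ?thesis
      unfolding cube_count_padovan_graph[OF nk] r by (simp add: t_def r_def)
  qed
  then show ?thesis by (simp add: cube_poly_def)
qed

end
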